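(* Let $K\subseteq\mathbb{R}^2$ be a convex body, $\lambda\in[0,1]$, and let $x$ be the center of mass of $K$. Then \[ \mathrm{Area}\big((1-\lambda)(K-x)\vee\lambda(x-K)\big)\le \mathrm{Area}\big((1-\lambda)S\vee(-\lambda S)\big), \] where $S$ is a triangle with center of mass at the origin and $\mathrm{Area}(S)=\mathrm{Area}(K)$.
   Context: A convex body is a compact convex set with non-empty interior. For sets $A,B$, $A\vee B$ denotes the convex hull of $A\cup B$. *)

theory Defs
  imports "HOL-Analysis.Analysis"
begin

definition convex_body :: "'a::euclidean_space set \<Rightarrow> bool" where
  "convex_body K \<longleftrightarrow> compact K \<and> convex K \<and> interior K \<noteq> {}"

definition center_of_mass :: "'a::euclidean_space set \<Rightarrow> 'a" where
  "center_of_mass K = (1 / measure lebesgue K) *\<^sub>R integral K (\<lambda>y. y)"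

definition cvx_join :: "'a::real_vector set \<Rightarrow> 'a set \<Rightarrow> 'a set" (infixl "\<squnion>\<^sub>c" 65) where
  "A \<squnion>\<^sub>c B = convex hull (A \<union> B)"

definition is_triangle :: "'a::real_vector set \<Rightarrow> bool" where
  "is_triangle S \<longleftrightarrow> (\<exists>a b c. \<not> collinear {a, b, c} \<and> S = convex hull {a, b, c})"

end

theory Submission
  imports Defs
begin

text \<open>
  Write \<open>J(K)\<close> for the join of \<open>(1 - l)(K - x)\<close> and \<open>l(x - K)\<close>, where \<open>x\<close> is the centroid of \<open>K\<close>.
  Let \<open>v\<close> be a vertex of a polygon with neighbours \<open>a\<close> and \<open>b\<close>, and move \<open>v\<close> parallel to \<open>b - a\<close>. The area is
  constant and the centroid moves affinely, so \<open>J\<close> of the polygon is a shadow system and its area is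
  a convex function of time. It is therefore bounded by its values at the two extreme times, when \<open>a\<close>
  or \<open>b\<close> ceases to be a vertex. By induction on the number of vertices the ratio
  \<open>area J(P) / area P\<close> is at most its value on a triangle, which is the same for all triangles
  because the ratio is affinely invariant. For a general \<open>K\<close> take a polygon \<open>P\<close> between a homothetic
  copy of \<open>K\<close> (centred at \<open>x\<close>) and \<open>K\<close>: since \<open>x\<close> is an interior point, \<open>J(P)\<close> contains a slightly shrunk \<open>J(K)\<close>.
\<close>

subsection \<open>Affine equivariance\<close>

text \<open>Both sides of the theorem are values of this functional: for a triangle centred at the
  origin the subtraction of the centroid disappears.\<close>

definition cjoin :: "real \<Rightarrow> (real^2) set \<Rightarrow> (real^2) set" where
  "cjoin l K = (\<lambda>y. (1 - l) *\<^sub>R (y - center_of_mass K)) ` K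
     \<squnion>\<^sub>c (\<lambda>y. l *\<^sub>R (center_of_mass K - y)) ` K"

lemma absolutely_integrable_on_compact:
  fixes f :: "'a::euclidean_space \<Rightarrow> 'b::euclidean_space"
  assumes "compact K" "continuous_on UNIV f"
  shows "f absolutely_integrable_on K"
proof -
  obtain a where "K \<subseteq> cbox (-a) a"
    using assms(1) bounded_subset_cbox_symmetric compact_imp_bounded by blast
  moreover have "f absolutely_integrable_on cbox (-a) a"
    using assms(2) absolutely_integrable_continuous continuous_on_subset by blast
  ultimately show ?thesis
    using assms(1) lmeasurable_compact set_integrable_subset by (metis fmeasurableD)
qed

lemma integrable_on_compact:
  fixes f :: "'a::euclidean_space \<Rightarrow> 'b::euclidean_space"
  assumes "compact K" "continuous_on UNIV f"
  shows "f integrable_on K"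
  using absolutely_integrable_on_compact[OF assms] set_lebesgue_integral_eq_integral(1) by blast

lemma measure_affine_image:
  fixes g :: "real^'n::{finite,wellorder} \<Rightarrow> real^'n::{finite,wellorder}"
  assumes "linear g" "compact K"
  shows "measure lebesgue ((\<lambda>y. p + g y) ` K) = \<bar>det (matrix g)\<bar> * measure lebesgue K"
proof -
  have "(\<lambda>y. p + g y) ` K = (+) p ` (g ` K)"
    by auto
  then show ?thesis
    using assms by (simp add: measure_translation measure_linear_image lmeasurable_compact)
qed

text \<open>Change of variables with constant Jacobian; the constant part of the map contributes
  area times \<open>p\<close>, the linear part commutes with the integral.\<close>

lemma integral_affine_image:
  fixes g :: "real^'n::{finite,wellorder} \<Rightarrow> real^'n::{finite,wellorder}"
  assumes "linear g" "bij g" "compact K"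
  shows "integral ((\<lambda>y. p + g y) ` K) (\<lambda>y. y)
    = \<bar>det (matrix g)\<bar> *\<^sub>R (measure lebesgue K *\<^sub>R p + g (integral K (\<lambda>y. y)))"
proof -
  have bl: "bounded_linear g"
    using assms(1) linear_conv_bounded_linear by blast
  have cont: "continuous_on UNIV g"
    using bl linear_continuous_on by blast
  have "integral ((\<lambda>y. p + g y) ` K) (\<lambda>y. y) = integral K (\<lambda>y. \<bar>det (matrix g)\<bar> *\<^sub>R (p + g y))"
  proof (rule integral_change_of_variables)
    show "K \<in> sets lebesgue"
      using assms(3) lmeasurable_compact by blast
    show "((\<lambda>y. p + g y) has_derivative g) (at y within K)" for y
      using bounded_linear_imp_has_derivative[OF bl] by (auto intro!: derivative_eq_intros)
    show "inj_on (\<lambda>y. p + g y) K"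
      using assms(2) by (auto simp: inj_on_def bij_def)
    have "compact ((\<lambda>y. p + g y) ` K)"
      by (intro compact_continuous_image continuous_intros continuous_on_subset[OF cont] assms) auto
    then show "(\<lambda>y. y) absolutely_integrable_on (\<lambda>y. p + g y) ` K \<or>
      (\<lambda>x. \<bar>det (matrix g)\<bar> *\<^sub>R (p + g x)) absolutely_integrable_on K"
      by (intro disjI1 absolutely_integrable_on_compact) simp_all
  qed
  also have "\<dots> = \<bar>det (matrix g)\<bar> *\<^sub>R (integral K (\<lambda>y. p) + integral K (\<lambda>y. g y))"
    using assms(3) cont by (subst integral_cmul, subst integral_add) (auto intro!: integrable_on_compact)
  also have "integral K (\<lambda>y. p) = measure lebesgue K *\<^sub>R p"
  proof -
    have "((\<lambda>x. 1 :: real) has_integral measure lebesgue K) K"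
      using assms(3) integrable_integral[OF integrable_on_compact[of K "\<lambda>x. 1 :: real"]]
      by (simp add: lmeasure_integral lmeasurable_compact)
    then have "((\<lambda>x. 1 *\<^sub>R p) has_integral measure lebesgue K *\<^sub>R p) K"
      by (rule has_integral_scaleR_left)
    then show ?thesis by (simp add: integral_unique)
  qed
  also have "integral K (\<lambda>y. g y) = g (integral K (\<lambda>y. y))"
    using integral_linear[of "\<lambda>y. y" K g] bl assms(3) by (simp add: o_def integrable_on_compact)
  finally show ?thesis .
qed

lemma det_matrix_bij_neq_0:
  fixes g :: "real^'n \<Rightarrow> real^'n"
  assumes "linear g" "bij g"
  shows "det (matrix g) \<noteq> 0"
  using assms by (simp add: bij_is_inj det_nz_iff_inj)

text \<open>The factor \<open>\<bar>det (matrix g)\<bar>\<close> occurs in both the first moment and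
  the area, and it cancels because a bijective \<open>g\<close> makes it nonzero.\<close>

lemma center_of_mass_affine_image:
  fixes g :: "real^'n::{finite,wellorder} \<Rightarrow> real^'n::{finite,wellorder}"
  assumes "linear g" "bij g" "compact K" "measure lebesgue K > 0"
  shows "center_of_mass ((\<lambda>y. p + g y) ` K) = p + g (center_of_mass K)"
  using assms(4) det_matrix_bij_neq_0[OF assms(1,2)] 
  unfolding center_of_mass_def integral_affine_image[OF assms(1-3)] measure_affine_image[OF assms(1,3)]
  by (simp add: linear_cmul[OF assms(1)] scaleR_add_right)

text \<open>The translation \<open>p\<close> drops out: \<open>cjoin\<close> sees only differences
  from the centroid, and those transform by \<open>g\<close> alone.\<close>

lemma cjoin_affine_image:
  assumes "linear g" "bij g" "compact K" "measure lebesgue K > 0"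
  shows "cjoin l ((\<lambda>y. p + g y) ` K) = g ` cjoin l K"
proof -
  interpret linear g by fact
  show ?thesis
    unfolding cjoin_def cvx_join_def center_of_mass_affine_image[OF assms]
      convex_hull_linear_image[OF assms(1)] image_Un image_image
    by (simp add: algebra_simps scale diff add)
qed

lemma compact_cjoin: 
  assumes "compact K" shows "compact (cjoin l K)"
  unfolding cjoin_def cvx_join_def
  by (intro compact_convex_hull compact_Un compact_continuous_image continuous_intros assms)

subsection \<open>Shadow systems in the plane\<close>

definition pt :: "real \<Rightarrow> real \<Rightarrow> real^2" where
  "pt s y = s *\<^sub>R axis 1 1 + y *\<^sub>R axis 2 1"

lemma pt_nth [simp]: "pt s y $ 1 = s" "pt s y $ 2 = y"
  by (auto simp: pt_def axis_def)

lemma pt_eta [simp]: "pt (p $ 1) (p $ 2) = p"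
  by (simp add: vec_eq_iff forall_2)

lemma pt_eq_iff [simp]: "pt s y = pt s' y' \<longleftrightarrow> s = s' \<and> y = y'"
  by (metis pt_nth)

lemma pt_cases: obtains s y where "p = pt s y"
  by (metis pt_eta)

lemma pt_add [simp]: "pt s y + pt s' y' = pt (s + s') (y + y')"
  and pt_diff [simp]: "pt s y - pt s' y' = pt (s - s') (y - y')"
  and pt_scaleR [simp]: "r *\<^sub>R pt s y = pt (r * s) (r * y)"
  by (simp_all add: vec_eq_iff forall_2)

lemma pt_zero: "0 = pt 0 0"
  by (simp add: vec_eq_iff forall_2)

lemma continuous_on_pt [continuous_intros]:
  "continuous_on S f \<Longrightarrow> continuous_on S g \<Longrightarrow> continuous_on S (\<lambda>x. pt (f x) (g x))"
  unfolding pt_def by (intro continuous_intros)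

text \<open>Both measures give every box the product of its side lengths, which determines Lebesgue
  measure. This carries Fubini from pairs over to \<open>real^2\<close>.\<close>

lemma lborel_vec2: "(lborel :: (real^2) measure) = distr (lborel \<Otimes>\<^sub>M lborel) borel (\<lambda>(s, y). pt s y)"
proof (rule lborel_eqI)
  have m: "(\<lambda>(s, y). pt s y) \<in> lborel \<Otimes>\<^sub>M lborel \<rightarrow>\<^sub>M borel"
    unfolding lborel_prod by (auto intro!: borel_measurable_continuous_onI continuous_intros simp: split_beta)
  fix l u :: "real^2"
  assume le: "\<And>b. b \<in> Basis \<Longrightarrow> l \<bullet> b \<le> u \<bullet> b"
  have le': "l $ 1 \<le> u $ 1" "l $ 2 \<le> u $ 2"
    using le[of "axis 1 1"] le[of "axis 2 1"] by (auto simp: inner_axis axis_in_Basis_iff)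
  have "(\<lambda>(s, y). pt s y) -` box l u \<inter> space (lborel \<Otimes>\<^sub>M lborel) = box (l $ 1) (u $ 1) \<times> box (l $ 2) (u $ 2)"
    by (auto simp: mem_box_cart forall_2 space_pair_measure)
  moreover have "(\<Prod>b\<in>Basis. (u - l) \<bullet> b) = (u $ 1 - l $ 1) * (u $ 2 - l $ 2)"
  proof -
    have B: "(Basis :: (real^2) set) = {axis 1 1, axis 2 1}"
      by (auto simp: Basis_vec_def UNIV_2)
    have "axis 1 1 \<noteq> (axis 2 1 :: real^2)"
      by (auto simp: axis_eq_axis)
    then show ?thesis unfolding B by (simp add: inner_axis)
  qed
  ultimately show "emeasure (distr (lborel \<Otimes>\<^sub>M lborel) borel (\<lambda>(s, y). pt s y)) (box l u)
      = (\<Prod>b\<in>Basis. (u - l) \<bullet> b)"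
    using le' by (simp add: emeasure_distr[OF m] lborel.emeasure_pair_measure_Times ennreal_mult)
qed auto

text \<open>Cavalieri's principle for vertical sections. Measurability of the section length is what
  later permits splitting the integral of a sum.\<close>

lemma
  fixes C :: "(real^2) set"
  assumes "C \<in> sets borel"
  shows emeasure_vec2_sections:
      "emeasure lborel C = (\<integral>\<^sup>+ s. emeasure lborel {y. pt s y \<in> C} \<partial>lborel)"
    and borel_measurable_sections: "(\<lambda>s. emeasure lborel {y. pt s y \<in> C}) \<in> borel_measurable lborel"
proof -
  let ?C = "{z. (\<lambda>(s, y). pt s y) z \<in> C}"
  have m: "(\<lambda>(s, y). pt s y) \<in> lborel \<Otimes>\<^sub>M lborel \<rightarrow>\<^sub>M borel"
    unfolding lborel_prod by (auto intro!: borel_measurable_continuous_onI continuous_intros simp: split_beta)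
  have C: "?C \<in> sets (lborel \<Otimes>\<^sub>M lborel)"
    using measurable_sets[OF m assms] by (simp add: vimage_def space_pair_measure)
  have "emeasure lborel C = emeasure (lborel \<Otimes>\<^sub>M lborel) ?C"
    by (subst lborel_vec2) (simp add: emeasure_distr[OF m assms] vimage_def space_pair_measure)
  also have "\<dots> = (\<integral>\<^sup>+ s. emeasure lborel {y. pt s y \<in> C} \<partial>lborel)"
    using lborel.emeasure_pair_measure_alt[OF C] by (simp add: vimage_def)
  finally show "emeasure lborel C = (\<integral>\<^sup>+ s. emeasure lborel {y. pt s y \<in> C} \<partial>lborel)" .
  show "(\<lambda>s. emeasure lborel {y. pt s y \<in> C}) \<in> borel_measurable lborel"
    using lborel.measurable_emeasure_Pair[OF C] by (simp add: vimage_def)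
qed

text \<open>The second component is a vertical speed. The plane at time \<open>t\<close> is seen as
  a projection of a three-dimensional space along a direction depending on \<open>t\<close>;
  abscissas never change.\<close>

definition shadow :: "real \<Rightarrow> (real^2) \<times> real \<Rightarrow> real^2" where
  "shadow t z = fst z + pt 0 (t * snd z)"

lemma linear_shadow: "linear (shadow t)"
  by (rule linearI) (auto simp: shadow_def pt_def algebra_simps)

lemma compact_shadow_image:
  assumes "compact Q" shows "compact (shadow t ` Q)"
  unfolding shadow_def by (intro compact_continuous_image continuous_intros assms)

text \<open>Equality can fail because \<open>ennreal\<close> truncates negative reals to 0.
  Differences of moving end points may become negative, so this case is needed.\<close>

lemma ennreal_add_le: "ennreal (a + b) \<le> ennreal a + ennreal b"
proof -
  have "ennreal (a + b) \<le> ennreal (max 0 a + max 0 b)"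
    by (rule ennreal_leI) auto
  also have "\<dots> = ennreal a + ennreal b"
    by (subst ennreal_plus) (auto simp: max_def ennreal_neg)
  finally show ?thesis .
qed

text \<open>The section of the moving shadow over a fixed abscissa is an interval whose length is a
  supremum of functions that are affine in time.\<close>

lemma emeasure_shadow_section:
  assumes "compact Q" "convex Q" "0 \<le> \<theta>" "\<theta> \<le> 1" and t: "t = (1 - \<theta>) * t0 + \<theta> * t1"
  shows "emeasure lborel {y. pt s y \<in> shadow t ` Q}
    \<le> ennreal (1 - \<theta>) * emeasure lborel {y. pt s y \<in> shadow t0 ` Q}
      + ennreal \<theta> * emeasure lborel {y. pt s y \<in> shadow t1 ` Q}"
proof (cases "{y. pt s y \<in> shadow t ` Q} = {}")
  case False
  define A where "A = (\<lambda>\<tau>. {y. pt s y \<in> shadow \<tau> ` Q})"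
  have cvx: "convex (A \<tau>)" for \<tau>
  proof (rule convexI)
    fix y y' u v :: real
    assume h: "y \<in> A \<tau>" "y' \<in> A \<tau>" "0 \<le> u" "0 \<le> v" "u + v = 1"
    have "u *\<^sub>R pt s y + v *\<^sub>R pt s y' \<in> shadow \<tau> ` Q"
      using convexD[OF convex_linear_image[OF linear_shadow assms(2)], of "pt s y" \<tau> "pt s y'" u v] h
      by (simp add: A_def)
    moreover have "u * s + v * s = s"
      using h(5) by (metis distrib_right mult_1)
    ultimately show "u *\<^sub>R y + v *\<^sub>R y' \<in> A \<tau>"
      by (simp add: A_def)
  qed
  have cpt: "compact (A \<tau>)" for \<tau>
  proof -
    have c: "compact (shadow \<tau> ` Q)"
      using assms(1) by (rule compact_shadow_image)
    then have "closed (A \<tau>)"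
      unfolding A_def vimage_def[symmetric]
      by (intro closed_vimage compact_imp_closed continuous_intros)
    moreover have "A \<tau> \<subseteq> (\<lambda>p. p $ 2) ` (shadow \<tau> ` Q)"
      by (auto simp: A_def image_iff) (metis pt_nth(2))
    then have "bounded (A \<tau>)"
      using c bounded_subset compact_imp_bounded bounded_linear_image bounded_linear_vec_nth by metis
    ultimately show ?thesis by (simp add: compact_eq_bounded_closed)
  qed
  have "\<exists>hi\<in>A t. \<forall>y\<in>A t. y \<le> hi" "\<exists>lo\<in>A t. \<forall>y\<in>A t. lo \<le> y"
    using False compact_attains_sup[OF cpt[of t]] compact_attains_inf[OF cpt[of t]] by (auto simp: A_def)
  then obtain hi lo where hl: "hi \<in> A t" "lo \<in> A t" "A t \<subseteq> {lo..hi}"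
    by (metis atLeastAtMost_iff subsetI)
  \<comment> \<open>A point of the section at time \<open>t\<close> comes from a point of
    \<open>Q\<close> over the same abscissa \<open>s\<close>, with some speed
    \<open>c\<close>.\<close>
  have ex: "\<exists>a c. (pt s a, c) \<in> Q \<and> y = a + t * c" if y: "y \<in> A t" for y
  proof -
    obtain z where "z \<in> Q" "pt s y = fst z + pt 0 (t * snd z)"
      using y by (auto simp: A_def shadow_def)
    then have "fst z = pt s (y - t * snd z)"
      by (metis add_diff_cancel_right' diff_zero pt_diff)
    then have "z = (pt s (y - t * snd z), snd z)"
      by (simp add: prod_eq_iff)
    with \<open>z \<in> Q\<close> have "(pt s (y - t * snd z), snd z) \<in> Q"
      by argo
    moreover have "y = (y - t * snd z) + t * snd z"
      by simp
    ultimately show ?thesis by blast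
  qed
  obtain a c where a: "(pt s a, c) \<in> Q" "hi = a + t * c"
    using ex hl by blast
  obtain b d where b: "(pt s b, d) \<in> Q" "lo = b + t * d"
    using ex hl by blast
  \<comment> \<open>The two points of \<open>Q\<close> that give the ends of the section at time
    \<open>t\<close> stay over \<open>s\<close> at all times. By convexity the section at time
    \<open>\<tau>\<close> contains the segment between them; if their order is reversed, the left
    side is 0.\<close>
  have low: "ennreal ((a + \<tau> * c) - (b + \<tau> * d)) \<le> emeasure lborel (A \<tau>)" for \<tau>
  proof -
    have ends: "a + \<tau> * c \<in> A \<tau>" "b + \<tau> * d \<in> A \<tau>"
      using imageI[OF a(1), of "shadow \<tau>"] imageI[OF b(1), of "shadow \<tau>"]
      by (simp_all add: A_def shadow_def)
    have "is_interval (A \<tau>)"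
      unfolding is_interval_convex_1 by (rule cvx)
    then have "{b + \<tau> * d..a + \<tau> * c} \<subseteq> A \<tau>"
      using ends mem_is_interval_1_I[of "A \<tau>" "b + \<tau> * d" "a + \<tau> * c"] by (simp add: subset_iff)
    moreover have "A \<tau> \<in> sets lborel"
      using cpt[of \<tau>] borel_compact by simp
    ultimately have "emeasure lborel {b + \<tau> * d..a + \<tau> * c} \<le> emeasure lborel (A \<tau>)"
      by (intro emeasure_mono)
    then show ?thesis
      by (cases "b + \<tau> * d \<le> a + \<tau> * c") (auto simp: ennreal_neg)
  qed
  have "emeasure lborel (A t) \<le> emeasure lborel {lo..hi}"
    using hl by (intro emeasure_mono) auto
  also have "\<dots> = ennreal (hi - lo)"
    using hl by (intro emeasure_lborel_Icc) auto
  also have "hi - lo = (1 - \<theta>) * ((a + t0 * c) - (b + t0 * d)) + \<theta> * ((a + t1 * c) - (b + t1 * d))"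
    unfolding a b t by (simp add: algebra_simps)
  also have "ennreal \<dots> \<le> ennreal (1 - \<theta>) * ennreal ((a + t0 * c) - (b + t0 * d))
      + ennreal \<theta> * ennreal ((a + t1 * c) - (b + t1 * d))"
    using assms(3,4) by (intro order_trans[OF ennreal_add_le]) (simp add: ennreal_mult')
  also have "\<dots> \<le> ennreal (1 - \<theta>) * emeasure lborel (A t0) + ennreal \<theta> * emeasure lborel (A t1)"
    by (intro add_mono mult_left_mono low) auto
  finally show ?thesis by (simp add: A_def)
qed simp

text \<open>The inequality for sections is integrated over all abscissas; compactness keeps the
  areas finite, so the result holds in the reals.\<close>

lemma measure_shadow_convex:
  assumes "compact Q" "convex Q" "0 \<le> \<theta>" "\<theta> \<le> 1" and t: "t = (1 - \<theta>) * t0 + \<theta> * t1"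
  shows "measure lebesgue (shadow t ` Q)
    \<le> (1 - \<theta>) * measure lebesgue (shadow t0 ` Q) + \<theta> * measure lebesgue (shadow t1 ` Q)"
proof -
  have b: "shadow \<tau> ` Q \<in> sets borel" for \<tau>
    using compact_shadow_image[OF assms(1)] borel_compact by blast
  have e: "emeasure lborel (shadow \<tau> ` Q) = ennreal (measure lebesgue (shadow \<tau> ` Q))" for \<tau>
    using emeasure_compact_finite[OF compact_shadow_image[OF assms(1)], of \<tau>] b
    by (simp add: emeasure_eq_ennreal_measure top.not_eq_extremum)
  have m: "(\<lambda>s. emeasure lborel {y. pt s y \<in> shadow \<tau> ` Q}) \<in> borel_measurable lborel" for \<tau>
    using borel_measurable_sections[OF b] .
  have "emeasure lborel (shadow t ` Q) \<le> (\<integral>\<^sup>+ s. ennreal (1 - \<theta>) * emeasure lborel {y. pt s y \<in> shadow t0 ` Q}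
      + ennreal \<theta> * emeasure lborel {y. pt s y \<in> shadow t1 ` Q} \<partial>lborel)"
    unfolding emeasure_vec2_sections[OF b]
    by (intro nn_integral_mono emeasure_shadow_section assms)
  also have "\<dots> = ennreal (1 - \<theta>) * emeasure lborel (shadow t0 ` Q) + ennreal \<theta> * emeasure lborel (shadow t1 ` Q)"
    unfolding emeasure_vec2_sections[OF b] using m
    by (simp add: nn_integral_add nn_integral_cmult)
  finally have "ennreal (measure lebesgue (shadow t ` Q))
      \<le> ennreal ((1 - \<theta>) * measure lebesgue (shadow t0 ` Q) + \<theta> * measure lebesgue (shadow t1 ` Q))"
    unfolding e using assms(3,4) by (subst ennreal_plus) (simp_all add: ennreal_mult')
  then show ?thesis
    using assms(3,4) by (subst (asm) ennreal_le_iff) simp_all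
qed

subsection \<open>Moving one vertex of a polygon\<close>

text \<open>It fixes the line of abscissa 0 pointwise and takes \<open>pt 1 0\<close> to
  \<open>pt 1 t\<close>, so it moves the apex of a triangle while keeping its base.\<close>

definition shear :: "real \<Rightarrow> real^2 \<Rightarrow> real^2" where
  "shear t p = p + pt 0 (t * p $ 1)"

lemma linear_shear: "linear (shear t)"
  by (rule linearI) (auto simp: shear_def vec_eq_iff forall_2 algebra_simps)

lemma bij_shear: "bij (shear t)"
  by (rule o_bij[where g = "shear (-t)"]) (auto simp: shear_def fun_eq_iff vec_eq_iff forall_2)

lemma det_shear: "det (matrix (shear t)) = 1"
  by (simp add: det_2 matrix_def shear_def axis_def)

text \<open>The part beyond the line \<open>s = 0\<close> of the cone with apex \<open>(1, t)\<close> through \<open>(0, 0)\<close> and \<open>(0, 1)\<close>. As long as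
  the other vertices lie there, adding the apex \<open>(1, t)\<close> enlarges their hull by a triangle only.\<close>

definition behind :: "real \<Rightarrow> (real^2) set" where
  "behind t = {p. p $ 1 \<le> 0 \<and> t * p $ 1 \<le> p $ 2 \<and> p $ 2 \<le> 1 - p $ 1 + t * p $ 1}"

definition apex_triangle :: "real \<Rightarrow> (real^2) set" where
  "apex_triangle t = convex hull {pt 0 0, pt 0 1, pt 1 t}"

lemma convex_behind: "convex (behind t)"
proof -
  have "behind t = {p. axis 1 1 \<bullet> p \<le> 0} \<inter> {p. pt t (-1) \<bullet> p \<le> 0} \<inter> {p. pt (1 - t) 1 \<bullet> p \<le> 1}"
    by (auto simp: behind_def inner_vec_def sum_2 axis_def algebra_simps)
  then show ?thesis
    by (simp add: convex_Int convex_halfspace_le)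
qed

lemma apex_triangle_shear: "apex_triangle t = shear t ` apex_triangle 0"
  unfolding apex_triangle_def convex_hull_linear_image[OF linear_shear]
  by (simp add: shear_def)

lemma compact_apex_triangle: "compact (apex_triangle t)"
  unfolding apex_triangle_def by (intro finite_imp_compact_convex_hull) auto

lemma measure_apex_triangle: "measure lebesgue (apex_triangle t) = measure lebesgue (apex_triangle 0)"
  using measure_affine_image[OF linear_shear compact_apex_triangle, of 0 t 0]
  by (simp add: apex_triangle_shear[of t] det_shear)

lemma integral_apex_triangle:
  "integral (apex_triangle t) (\<lambda>y. y) = shear t (integral (apex_triangle 0) (\<lambda>y. y))"
  using integral_affine_image[OF linear_shear bij_shear compact_apex_triangle, of 0 t 0]
  by (simp add: apex_triangle_shear[of t] det_shear)

text \<open>A segment from the apex to a point of \<open>convex hull V\<close> crosses abscissa 0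
  between \<open>pt 0 0\<close> and \<open>pt 0 1\<close>, since that point lies in
  \<open>behind t\<close>. The crossing point belongs to both pieces and cuts the segment into a
  part in each.\<close>

lemma hull_insert_apex:
  assumes "pt 0 0 \<in> V" "pt 0 1 \<in> V" "V \<subseteq> behind t"
  shows "convex hull (insert (pt 1 t) V) = convex hull V \<union> apex_triangle t"
proof
  have "convex hull V \<subseteq> convex hull insert (pt 1 t) V"
    by (rule hull_mono) auto
  moreover have "apex_triangle t \<subseteq> convex hull insert (pt 1 t) V"
    unfolding apex_triangle_def using assms by (intro hull_mono) auto
  ultimately show "convex hull V \<union> apex_triangle t \<subseteq> convex hull insert (pt 1 t) V"
    by blast
next
  show "convex hull insert (pt 1 t) V \<subseteq> convex hull V \<union> apex_triangle t"
  proof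
    fix z assume "z \<in> convex hull insert (pt 1 t) V"
    moreover have "V \<noteq> {}" using assms by auto
    ultimately obtain u v w where uvw: "0 \<le> u" "0 \<le> v" "u + v = 1" "w \<in> convex hull V"
        "z = u *\<^sub>R pt 1 t + v *\<^sub>R w"
      unfolding convex_hull_insert[OF \<open>V \<noteq> {}\<close>] by blast
    obtain s y where w: "w = pt s y" by (rule pt_cases)
    have "convex hull V \<subseteq> behind t"
      by (intro hull_minimal assms convex_behind)
    then have "w \<in> behind t"
      using uvw(4) by blast
    then have sy: "s \<le> 0" "t * s \<le> y" "y \<le> 1 - s + t * s"
      by (auto simp: behind_def w)
    \<comment> \<open>The ordinate at which the line through \<open>w\<close> and the apex
      \<open>pt 1 t\<close> meets abscissa 0.\<close>
    define m where "m = (y - s * t) / (1 - s)"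
    have m01: "0 \<le> m" "m \<le> 1"
      using sy by (auto simp: m_def field_simps)
    have "pt 0 m = (1 - m) *\<^sub>R pt 0 0 + m *\<^sub>R pt 0 1"
      by simp
    then have mhull: "pt 0 m \<in> convex hull S" if "pt 0 0 \<in> S" "pt 0 1 \<in> S" for S
      using that m01 convexD[OF convex_convex_hull, of "pt 0 0" S "pt 0 1" "1 - m" m] by (auto intro: hull_inc)
    have u: "u = 1 - v" using uvw by simp
    have z: "z = pt (u + v * s) (u * t + v * y)"
      unfolding uvw w by simp
    show "z \<in> convex hull V \<union> apex_triangle t"
    proof (cases "u + v * s \<le> 0")
      case True
      have "z \<in> convex hull V"
      proof (cases "s = 0")
        case True
        then have "u = 0" using \<open>u + v * s \<le> 0\<close> uvw by simp
        then show ?thesis using uvw by (simp flip: pt_zero)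
      next
        case False
        then have s: "s < 0" using sy by simp
        \<comment> \<open>The weight of \<open>w\<close> when \<open>z\<close> is written as a
          combination of \<open>w\<close> and \<open>pt 0 m\<close>, found by comparing
          abscissas.\<close>
        define a where "a = (u + v * s) / s"
        have "0 \<le> a" using True s by (auto simp: a_def divide_nonpos_neg)
        have a': "1 - a = - ((1 - s) * u / s)"
          using s unfolding a_def u by (simp add: field_simps)
        have "0 \<le> 1 - a" unfolding a' using s uvw by (auto simp: divide_nonneg_neg)
        have "(1 - a) * m = - (u * (y - s * t) / s)"
          using s unfolding a' m_def by simp
        then have "a *\<^sub>R w + (1 - a) *\<^sub>R pt 0 m = z"
          using s unfolding w z a_def by (simp add: field_simps)
        moreover have "a *\<^sub>R w + (1 - a) *\<^sub>R pt 0 m \<in> convex hull V"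
          using \<open>0 \<le> a\<close> \<open>0 \<le> 1 - a\<close> uvw(4) mhull[OF assms(1,2)]
          by (intro convexD[OF convex_convex_hull]) auto
        ultimately show ?thesis by simp
      qed
      then show ?thesis by simp
    next
      case False
      \<comment> \<open>The abscissa of \<open>z\<close>, hence the weight of the apex when
        \<open>z\<close> is a combination of \<open>pt 1 t\<close> and
        \<open>pt 0 m\<close>.\<close>
      define b where "b = u + v * s"
      have b': "1 - b = v * (1 - s)" unfolding b_def u by (simp add: algebra_simps)
      have "0 \<le> b" using False by (simp add: b_def)
      have "0 \<le> 1 - b" unfolding b' using sy uvw by simp
      have "(1 - b) * m = v * (y - s * t)"
        unfolding b' m_def using sy by simp
      then have "b *\<^sub>R pt 1 t + (1 - b) *\<^sub>R pt 0 m = z"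
        unfolding z b_def u by (simp add: algebra_simps)
      moreover have "b *\<^sub>R pt 1 t + (1 - b) *\<^sub>R pt 0 m \<in> apex_triangle t"
        unfolding apex_triangle_def using \<open>0 \<le> b\<close> \<open>0 \<le> 1 - b\<close> mhull[of "{pt 0 0, pt 0 1, pt 1 t}"]
        by (intro convexD[OF convex_convex_hull]) (auto intro: hull_inc)
      ultimately show ?thesis by simp
    qed
  qed
qed

text \<open>The two pieces lie in opposite closed half-planes and can meet only on the line of
  abscissa 0.\<close>

lemma negligible_apex_triangle_Int:
  assumes "V \<subseteq> behind t"
  shows "negligible (convex hull V \<inter> apex_triangle t)"
proof -
  have c: "axis 1 1 \<bullet> p = p $ 1" for p :: "real^2"
    by (simp add: inner_axis')
  have cvx: "convex {p :: real^2. 0 \<le> p $ 1}"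
    using convex_halfspace_ge[of 0 "axis 1 (1::real) :: real^2"] by (simp add: c)
  have "convex hull V \<subseteq> behind t"
    by (intro hull_minimal assms convex_behind)
  moreover have "apex_triangle t \<subseteq> {p. axis 1 1 \<bullet> p \<ge> 0}"
    unfolding apex_triangle_def by (rule hull_minimal) (auto simp: c cvx)
  ultimately have "convex hull V \<inter> apex_triangle t \<subseteq> {p. axis 1 1 \<bullet> p = 0}"
    by (fastforce simp: behind_def c)
  moreover have "negligible {p :: real^2. axis 1 1 \<bullet> p = 0}"
    by (rule negligible_hyperplane) (auto simp: axis_eq_0_iff)
  ultimately show ?thesis by (rule negligible_subset[rotated])
qed

text \<open>The right side is free of \<open>t\<close>: sliding the apex along abscissa 1 preserves
  the area.\<close>

lemma measure_hull_insert_apex: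
  assumes "finite V" "pt 0 0 \<in> V" "pt 0 1 \<in> V" "V \<subseteq> behind t"
  shows "measure lebesgue (convex hull (insert (pt 1 t) V))
    = measure lebesgue (convex hull V) + measure lebesgue (apex_triangle 0)"
proof -
  have "measure lebesgue (convex hull V \<union> apex_triangle t)
      = measure lebesgue (convex hull V) + measure lebesgue (apex_triangle t)"
  proof (rule measure_Un_AE)
    have "convex hull V \<inter> apex_triangle t \<in> null_sets lebesgue"
      using negligible_apex_triangle_Int[OF assms(4)] by (simp add: negligible_iff_null_sets)
    from AE_not_in[OF this] show "AE x in lebesgue. x \<notin> convex hull V \<or> x \<notin> apex_triangle t"
      by eventually_elim auto
  qed (use assms(1) compact_apex_triangle lmeasurable_compact finite_imp_compact_convex_hull in blast)+
  then show ?thesis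
    unfolding hull_insert_apex[OF assms(2-4)] measure_apex_triangle[of t] .
qed

text \<open>The constants are chosen before \<open>t\<close>, so the centroid moves vertically at
  the constant speed \<open>k\<close>. Only the first moment of the apex triangle changes, by a
  shear, and the area in the denominator is constant.\<close>

lemma center_of_mass_hull_insert_apex:
  assumes "finite V" "pt 0 0 \<in> V" "pt 0 1 \<in> V"
  obtains c k where "\<And>t. V \<subseteq> behind t \<Longrightarrow>
    center_of_mass (convex hull (insert (pt 1 t) V)) = shadow t (c, k)"
proof -
  define M where "M = measure lebesgue (convex hull V) + measure lebesgue (apex_triangle 0)"
  define I where "I = integral (convex hull V) (\<lambda>y. y)"
  define J where "J = integral (apex_triangle 0) (\<lambda>y. y)"
  have "center_of_mass (convex hull (insert (pt 1 t) V)) = shadow t ((1/M) *\<^sub>R (I + J), (1/M) * J $ 1)"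
    if t: "V \<subseteq> behind t" for t
  proof -
    have "integral (convex hull V \<union> apex_triangle t) (\<lambda>y. y) = I + shear t J"
      unfolding I_def J_def integral_apex_triangle[symmetric]
      using assms(1) compact_apex_triangle
      by (intro integral_Un integrable_on_compact negligible_apex_triangle_Int[OF t])
        (auto intro: finite_imp_compact_convex_hull)
    then show ?thesis
      unfolding center_of_mass_def hull_insert_apex[OF assms(2,3) t, symmetric]
        measure_hull_insert_apex[OF assms t] M_def[symmetric]
      by (simp add: shadow_def shear_def scaleR_add_right algebra_simps)
  qed
  then show ?thesis using that by blast
qed

text \<open>Being linear, \<open>shadow t\<close> commutes with the hulls, scalings and differences
  in \<open>cjoin\<close>. Lifting vertices and centroid together with their speeds therefore lifts
  the whole join.\<close>

lemma cjoin_hull_insert_apex: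
  assumes "finite V" "pt 0 0 \<in> V" "pt 0 1 \<in> V"
  obtains Q where "compact Q" "convex Q"
    "\<And>t. V \<subseteq> behind t \<Longrightarrow> cjoin l (convex hull (insert (pt 1 t) V)) = shadow t ` Q"
proof -
  obtain c k where ck: "\<And>t. V \<subseteq> behind t \<Longrightarrow>
    center_of_mass (convex hull (insert (pt 1 t) V)) = shadow t (c, k)"
    using center_of_mass_hull_insert_apex[OF assms] by blast
  \<comment> \<open>The apex has speed 1 and every point of \<open>V\<close> speed 0.\<close>
  define W where "W = convex hull (insert (pt 1 0, 1 :: real) ((\<lambda>e. (e, 0)) ` V))"
  define Q where "Q = convex hull ((\<lambda>z. (1 - l) *\<^sub>R (z - (c, k))) ` W \<union> (\<lambda>z. l *\<^sub>R ((c, k) - z)) ` W)"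
  have "compact W"
    unfolding W_def using assms by (intro finite_imp_compact_convex_hull) auto
  then have "compact Q"
    unfolding Q_def by (intro compact_convex_hull compact_Un compact_continuous_image continuous_intros)
  moreover have "convex Q"
    unfolding Q_def by (rule convex_convex_hull)
  moreover have "cjoin l (convex hull (insert (pt 1 t) V)) = shadow t ` Q" if t: "V \<subseteq> behind t" for t
  proof -
    interpret linear "shadow t" by (rule linear_shadow)
    have W: "convex hull (insert (pt 1 t) V) = shadow t ` W"
      unfolding W_def convex_hull_linear_image[OF linear_shadow]
      by (simp add: image_image shadow_def flip: pt_zero)
    show ?thesis
      unfolding cjoin_def cvx_join_def ck[OF t]
      unfolding W Q_def convex_hull_linear_image[OF linear_shadow] image_Un image_image
      by (simp only: scale diff)
  qed
  ultimately show ?thesis using that by blast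
qed

text \<open>A convex function of time is bounded on an interval by its larger end value. The case
  \<open>t0 = t1\<close> is separate because the interpolation parameter divides by
  \<open>t1 - t0\<close>.\<close>

lemma measure_cjoin_apex_le_max:
  assumes "finite V" "pt 0 0 \<in> V" "pt 0 1 \<in> V"
    "V \<subseteq> behind t0" "V \<subseteq> behind t" "V \<subseteq> behind t1" "t0 \<le> t" "t \<le> t1"
  shows "measure lebesgue (cjoin l (convex hull (insert (pt 1 t) V)))
    \<le> max (measure lebesgue (cjoin l (convex hull (insert (pt 1 t0) V))))
        (measure lebesgue (cjoin l (convex hull (insert (pt 1 t1) V))))" (is "?m t \<le> max (?m t0) (?m t1)")
proof (cases "t0 = t1")
  case True
  then have "t = t0" using assms(7,8) by simp
  then show ?thesis by simp
next
  case False
  obtain Q where Q: "compact Q" "convex Q"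
    "\<And>t. V \<subseteq> behind t \<Longrightarrow> cjoin l (convex hull (insert (pt 1 t) V)) = shadow t ` Q"
    using cjoin_hull_insert_apex[OF assms(1-3)] by blast
  define \<theta> where "\<theta> = (t - t0) / (t1 - t0)"
  have "\<theta> * (t1 - t0) = t - t0"
    using False by (simp add: \<theta>_def)
  then have "t = (1 - \<theta>) * t0 + \<theta> * t1"
    by (simp add: algebra_simps)
  moreover have "0 \<le> \<theta>" "\<theta> \<le> 1"
    using assms(7,8) False by (auto simp: \<theta>_def divide_le_eq)
  ultimately have \<theta>: "0 \<le> \<theta>" "\<theta> \<le> 1" "t = (1 - \<theta>) * t0 + \<theta> * t1"
    by auto
  have "?m t \<le> (1 - \<theta>) * ?m t0 + \<theta> * ?m t1"
    unfolding Q(3)[OF assms(4)] Q(3)[OF assms(5)] Q(3)[OF assms(6)]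
    by (rule measure_shadow_convex[OF Q(1,2) \<theta>])
  also have "\<dots> \<le> (1 - \<theta>) * max (?m t0) (?m t1) + \<theta> * max (?m t0) (?m t1)"
    using \<theta> by (intro add_mono mult_left_mono) auto
  also have "\<dots> = max (?m t0) (?m t1)"
    by (simp add: algebra_simps)
  finally show ?thesis .
qed

subsection \<open>Planar frames and the neighbours of a vertex\<close>

definition cross2 :: "real^2 \<Rightarrow> real^2 \<Rightarrow> real" where
  "cross2 p q = p $ 1 * q $ 2 - p $ 2 * q $ 1"

definition frame :: "real^2 \<Rightarrow> real^2 \<Rightarrow> real^2 \<Rightarrow> real^2" where
  "frame p q z = z $ 1 *\<^sub>R p + z $ 2 *\<^sub>R q"

lemma linear_frame: "linear (frame p q)"
  by (rule linearI) (auto simp: frame_def algebra_simps)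

lemma frame_pt [simp]: "frame p q (pt s y) = s *\<^sub>R p + y *\<^sub>R q"
  by (simp add: frame_def)

text \<open>Cramer's rule.\<close>

lemma frame_coordinates:
  assumes "cross2 p q \<noteq> 0"
  shows "frame p q (pt (cross2 x q / cross2 p q) (cross2 p x / cross2 p q)) = x"
proof -
  have "cross2 p q *\<^sub>R x = cross2 x q *\<^sub>R p + cross2 p x *\<^sub>R q"
    by (simp add: vec_eq_iff forall_2 cross2_def algebra_simps)
  then have "x = (1 / cross2 p q) *\<^sub>R (cross2 x q *\<^sub>R p + cross2 p x *\<^sub>R q)"
    using assms by (metis divide_inverse_commute divide_self_if mult.commute scaleR_one scaleR_scaleR times_divide_eq_left)
  then show ?thesis by (simp add: scaleR_add_right)
qed

lemma bij_frame:
  assumes "cross2 p q \<noteq> 0"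
  shows "bij (frame p q)"
proof -
  have "surj (frame p q)"
    by (metis frame_coordinates[OF assms] surj_def)
  then show ?thesis
    using linear_surjective_imp_injective[OF linear_frame] by (simp add: bij_def)
qed

lemma negligible_line:
  assumes "p \<noteq> 0" shows "negligible {z. cross2 p (z - a) = 0}"
proof -
  \<comment> \<open>This is \<open>p\<close> turned by a right angle, a normal vector of the
    line.\<close>
  have "pt (- p $ 2) (p $ 1) \<noteq> 0"
    using assms by (auto simp: vec_eq_iff forall_2)
  then have "negligible {z. pt (- p $ 2) (p $ 1) \<bullet> z = cross2 p a}"
    by (intro negligible_hyperplane) auto
  moreover have "{z. pt (- p $ 2) (p $ 1) \<bullet> z = cross2 p a} = {z. cross2 p (z - a) = 0}"
    by (auto simp: cross2_def inner_vec_def sum_2 algebra_simps)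
  ultimately show ?thesis by simp
qed

lemma negligible_hull_line:
  assumes "p \<noteq> 0" "\<And>e. e \<in> V \<Longrightarrow> cross2 p (e - a) = 0"
  shows "negligible (convex hull V)"
proof (rule negligible_subset[OF negligible_line[OF assms(1), of a]])
  have "{z. cross2 p (z - a) = 0} = {z. pt (- p $ 2) (p $ 1) \<bullet> z = cross2 p a}"
    by (auto simp: cross2_def inner_vec_def sum_2 algebra_simps)
  then have "convex {z. cross2 p (z - a) = 0}"
    by (simp add: convex_hyperplane)
  then show "convex hull V \<subseteq> {z. cross2 p (z - a) = 0}"
    using assms(2) by (intro hull_minimal) auto
qed

lemma negligible_degenerate_triangle:
  assumes "cross2 (b - a) (c - a) = 0"
  shows "negligible (convex hull {a, b, c})"
proof (cases "b = a")
  case False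
  then show ?thesis
    using assms by (intro negligible_hull_line[of "b - a" _ a]) (auto simp: cross2_def)
next
  \<comment> \<open>The direction \<open>b - a\<close> vanishes here, so \<open>c - a\<close> takes
    its place; if that vanishes too, the hull is a single point.\<close>
  case ba: True
  show ?thesis
  proof (cases "c = a")
    case False
    then show ?thesis
      using ba by (intro negligible_hull_line[of "c - a" _ a]) (auto simp: cross2_def)
  qed (use ba in simp)
qed

text \<open>The edges at \<open>v\<close> are the extremal directions in the pointed cone spanned by \<open>V - v\<close>.\<close>

lemma vertex_neighbours:
  assumes "finite V" "v \<in> V" "v \<notin> convex hull (V - {v})" "\<not> negligible (convex hull V)"
  obtains a b where "a \<in> V - {v}" "b \<in> V - {v}" "cross2 (a - v) (b - v) > 0"
    "\<And>e. e \<in> V \<Longrightarrow> cross2 (a - v) (e - v) \<ge> 0"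
    "\<And>e. e \<in> V \<Longrightarrow> cross2 (e - v) (b - v) \<ge> 0"
proof -
  have fin: "finite (V - {v})" using assms(1) by simp
  have "closed (convex hull (V - {v}))"
    using fin by (intro compact_imp_closed finite_imp_compact_convex_hull)
  \<comment> \<open>Strict separation of \<open>v\<close> from the other points puts all their
    directions from \<open>v\<close> into one open half-plane.\<close>
  then obtain d \<beta> where "d \<bullet> v < \<beta>" "\<And>x. x \<in> convex hull (V - {v}) \<Longrightarrow> \<beta> < d \<bullet> x"
    using separating_hyperplane_closed_point[OF convex_convex_hull _ assms(3)] by blast
  then have pos: "d \<bullet> (e - v) > 0" if "e \<in> V - {v}" for e
    using that hull_inc[of e "V - {v}"] by (fastforce simp: inner_diff_right)
  \<comment> \<open>The tangent of the angle from \<open>d\<close> to \<open>e - v\<close>. It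
    increases with the angle in this half-plane, so its minimum and maximum mark the extremal
    directions.\<close>
  define r where "r = (\<lambda>e. cross2 d (e - v) / (d \<bullet> (e - v)))"
  have cr: "cross2 (p - v) (q - v) * (d \<bullet> d) = (d \<bullet> (p - v)) * (d \<bullet> (q - v)) * (r q - r p)"
    if "p \<in> V - {v}" "q \<in> V - {v}" for p q
  proof -
    have *: "cross2 x y * (d \<bullet> d) = (d \<bullet> x) * cross2 d y - (d \<bullet> y) * cross2 d x" for x y
      by (simp add: cross2_def inner_vec_def sum_2) algebra
    have p: "cross2 d (p - v) = r p * (d \<bullet> (p - v))" and q: "cross2 d (q - v) = r q * (d \<bullet> (q - v))"
      using pos[OF that(1)] pos[OF that(2)] by (auto simp: r_def)
    show ?thesis unfolding *[of "p - v"] p q by algebra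
  qed
  have "V - {v} \<noteq> {}"
  proof
    assume "V - {v} = {}"
    then have "V = {v}" using assms(2) by auto
    then show False using assms(4) by simp
  qed
  then have dd: "d \<bullet> d > 0" using pos by fastforce
  have rfin: "finite (r ` (V - {v}))" "r ` (V - {v}) \<noteq> {}" using fin \<open>V - {v} \<noteq> {}\<close> by auto
  then have mn: "Min (r ` (V - {v})) \<in> r ` (V - {v})" and mx: "Max (r ` (V - {v})) \<in> r ` (V - {v})"
    by (meson Min_in Max_in)+
  obtain a where "a \<in> V - {v}" "r a = Min (r ` (V - {v}))"
    using mn by (elim imageE) simp
  moreover obtain b where "b \<in> V - {v}" "r b = Max (r ` (V - {v}))"
    using mx by (elim imageE) simp
  ultimately have a: "a \<in> V - {v}" "\<And>e. e \<in> V - {v} \<Longrightarrow> r a \<le> r e"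
    and b: "b \<in> V - {v}" "\<And>e. e \<in> V - {v} \<Longrightarrow> r e \<le> r b"
    using rfin(1) by simp_all
  have sgn: "cross2 (p - v) (q - v) \<ge> 0" if "p \<in> V - {v}" "q \<in> V - {v}" "r p \<le> r q" for p q
  proof -
    have "0 \<le> cross2 (p - v) (q - v) * (d \<bullet> d)"
      unfolding cr[OF that(1,2)] using pos[OF that(1)] pos[OF that(2)] that(3) by simp
    then show ?thesis using dd by (simp add: zero_le_mult_iff)
  qed
  \<comment> \<open>Equal extreme angles would put all of \<open>V\<close> on one line through
    \<open>v\<close>.\<close>
  have "r a \<noteq> r b"
  proof
    assume "r a = r b"
    then have "cross2 (a - v) (e - v) = 0" if "e \<in> V" for e
    proof (cases "e = v")
      case False
      then have "r e = r a" using a b that \<open>r a = r b\<close> by (metis DiffI antisym singletonD)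
      then show ?thesis using cr[of a e] a(1) that False dd by simp
    qed (simp add: cross2_def)
    then have "negligible (convex hull V)"
      using a(1) by (intro negligible_hull_line[of "a - v" V v]) auto
    then show False using assms(4) by simp
  qed
  then have "r a < r b" using a b by fastforce
  then have "cross2 (a - v) (b - v) * (d \<bullet> d) > 0"
    unfolding cr[OF a(1) b(1)] using pos[OF a(1)] pos[OF b(1)] by simp
  then have "cross2 (a - v) (b - v) > 0" using dd by (simp add: zero_less_mult_iff)
  moreover have "cross2 (a - v) (e - v) \<ge> 0" "cross2 (e - v) (b - v) \<ge> 0" if "e \<in> V" for e
    using sgn[of a e] sgn[of e b] a b that by (cases "e = v"; simp add: cross2_def)+
  ultimately show ?thesis using that a(1) b(1) by blast
qed

subsection \<open>Reduction of polygons to triangles\<close>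

lemma convex_hull_Diff_redundant:
  assumes "x \<in> convex hull (V - {x})"
  shows "convex hull V = convex hull (V - {x})"
proof (cases "x \<in> V")
  case True
  then have "convex hull V = convex hull (insert x (V - {x}))"
    by (simp add: insert_absorb)
  also have "\<dots> = convex hull (V - {x})"
    by (rule hull_redundant[OF assms])
  finally show ?thesis .
qed simp

text \<open>The equation says that \<open>e\<close> lies on the line through \<open>pt 1 t\<close>
  and \<open>pt 0 m\<close>. Since \<open>e\<close> is beyond abscissa 0, \<open>pt 0 m\<close> is
  on the segment from \<open>e\<close> to the apex and is redundant.\<close>

lemma hull_drop_neighbour:
  assumes "e \<in> V" "e $ 1 < 0" "e $ 2 = m * (1 - e $ 1) + t * e $ 1" 
  shows "convex hull (insert (pt 1 t) V) = convex hull (insert (pt 1 t) (V - {pt 0 m}))"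
proof -
  obtain s y where e: "e = pt s y" by (rule pt_cases)
  define a where "a = 1 / (1 - s)"
  have s: "s < 0" "y = m * (1 - s) + t * s" using assms e by auto
  have a: "0 \<le> a" "0 \<le> 1 - a" using s by (auto simp: a_def)
  have "a *\<^sub>R e + (1 - a) *\<^sub>R pt 1 t \<in> convex hull (insert (pt 1 t) V - {pt 0 m})"
    using a assms e s by (intro convexD[OF convex_convex_hull] hull_inc) auto
  also have "a *\<^sub>R e + (1 - a) *\<^sub>R pt 1 t = pt 0 m"
  proof -
    have "a * (1 - s) = 1" using s by (simp add: a_def)
    then have "a * s + (1 - a) = 0" "a * y + (1 - a) * t = m"
      unfolding s(2) by algebra+
    then show ?thesis by (simp add: e)
  qed
  finally have "convex hull (insert (pt 1 t) V) = convex hull (insert (pt 1 t) V - {pt 0 m})"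
    by (rule convex_hull_Diff_redundant)
  also have "insert (pt 1 t) V - {pt 0 m} = insert (pt 1 t) (V - {pt 0 m})"
    by auto
  finally show ?thesis .
qed

text \<open>The induction step in coordinates: the moving vertex is \<open>pt 1 0\<close> and its
  neighbours are \<open>pt 0 0\<close> and \<open>pt 0 1\<close>. The \<open>cone\<close> hypotheses
  bound \<open>W\<close> by the two edges at that vertex.\<close>

lemma cjoin_area_bound_normalized:
  assumes fin: "finite W" and card: "card W > 3"
    and irr: "\<And>e. e \<in> W \<Longrightarrow> e \<notin> convex hull (W - {e})"
    and tri: "pt 0 0 \<in> W" "pt 0 1 \<in> W" "pt 1 0 \<in> W"
    and cone: "\<And>e. e \<in> W \<Longrightarrow> 0 \<le> e $ 2" "\<And>e. e \<in> W \<Longrightarrow> e $ 2 \<le> 1 - e $ 1"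
    and area: "measure lebesgue (convex hull W) > 0"
    and IH: "\<And>U. finite U \<Longrightarrow> card U < card W \<Longrightarrow> measure lebesgue (convex hull U) > 0 \<Longrightarrow>
      measure lebesgue (cjoin l (convex hull U)) \<le> c * measure lebesgue (convex hull U)"
  shows "measure lebesgue (cjoin l (convex hull W)) \<le> c * measure lebesgue (convex hull W)"
proof -
  define V where "V = W - {pt 1 0}"
  have finV: "finite V" and cardV: "card V < card W" and V0: "pt 0 0 \<in> V" and V1: "pt 0 1 \<in> V"
    and W: "W = insert (pt 1 0) V"
    using fin tri card_Diff1_less[OF fin tri(3)] by (auto simp: V_def)
  \<comment> \<open>A further vertex of nonnegative abscissa would lie in the triangle of the three
    given ones, contradicting \<open>irr\<close>.\<close>
  have neg: "e $ 1 < 0" if e: "e \<in> V" "e \<noteq> pt 0 0" "e \<noteq> pt 0 1" for e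
  proof (rule ccontr)
    assume "\<not> e $ 1 < 0"
    obtain s y where sy: "e = pt s y" by (rule pt_cases)
    have W: "e \<in> W" "e \<noteq> pt 1 0" using e by (auto simp: V_def)
    have "(1 - s - y) *\<^sub>R pt 0 0 + s *\<^sub>R pt 1 0 + y *\<^sub>R pt 0 1 \<in> convex hull {pt 0 0, pt 1 0, pt 0 1}"
      unfolding convex_hull_3 mem_Collect_eq using \<open>\<not> e $ 1 < 0\<close> cone[OF W(1)] sy
      by (intro exI[of _ "1 - s - y"] exI[of _ s] exI[of _ y]) auto
    also have "\<dots> \<subseteq> convex hull (W - {e})"
      using e W tri by (intro hull_mono) auto
    finally show False using irr[OF W(1)] sy by simp
  qed
  have nonpos: "e $ 1 \<le> 0" if "e \<in> V" for e
    using neg[OF that] by fastforce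
  define N where "N = {e \<in> V. e $ 1 < 0}"
  have finN: "finite N" using finV by (simp add: N_def)
  have "N \<noteq> {}"
  proof
    assume "N = {}"
    then have "W \<subseteq> {pt 0 0, pt 0 1, pt 1 0}"
      using neg by (auto simp: N_def W)
    then have "card W \<le> card {pt 0 0, pt 0 1, pt 1 0}"
      by (intro card_mono) auto
    also have "\<dots> \<le> 3" by (rule order_trans[OF card_insert_le_m1]) (auto simp: card_insert_if)
    finally show False using card by simp
  qed
  \<comment> \<open>Dividing by the negative abscissas turns the position condition into lower and
    upper bounds on \<open>t\<close>.\<close>
  have behind_iff: "V \<subseteq> behind t \<longleftrightarrow> (\<forall>e\<in>N. e $ 2 / e $ 1 \<le> t \<and> t \<le> (e $ 2 - 1 + e $ 1) / e $ 1)" for t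
  proof -
    have *: "e \<in> behind t \<longleftrightarrow> e $ 2 / e $ 1 \<le> t \<and> t \<le> (e $ 2 - 1 + e $ 1) / e $ 1" if "e \<in> N" for e
    proof -
      have "e $ 1 < 0" using that by (simp add: N_def)
      then show ?thesis
        by (auto simp: behind_def neg_divide_le_eq neg_le_divide_eq algebra_simps)
    qed
    have "e \<in> behind t" if "e \<in> V - N" for e
      using that neg[of e] by (cases "e = pt 0 0 \<or> e = pt 0 1") (auto simp: N_def behind_def)
    then show ?thesis using * by (auto simp: N_def)
  qed
  \<comment> \<open>The extreme admissible times. At \<open>t0\<close> some vertex is aligned with
    the apex and \<open>pt 0 0\<close>, at \<open>t1\<close> some vertex is aligned with the apex
    and \<open>pt 0 1\<close>.\<close>
  define t0 where "t0 = Max ((\<lambda>e. e $ 2 / e $ 1) ` N)"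
  define t1 where "t1 = Min ((\<lambda>e. (e $ 2 - 1 + e $ 1) / e $ 1) ` N)"
  have "t0 \<in> (\<lambda>e. e $ 2 / e $ 1) ` N" "t1 \<in> (\<lambda>e. (e $ 2 - 1 + e $ 1) / e $ 1) ` N"
    unfolding t0_def t1_def using finN \<open>N \<noteq> {}\<close> by (auto intro!: Max_in Min_in)
  then obtain e0 e1 where e0: "e0 \<in> N" "t0 = e0 $ 2 / e0 $ 1" and e1: "e1 \<in> N" "t1 = (e1 $ 2 - 1 + e1 $ 1) / e1 $ 1"
    by blast
  have t0: "e $ 2 / e $ 1 \<le> t0" and t1: "t1 \<le> (e $ 2 - 1 + e $ 1) / e $ 1" if "e \<in> N" for e
    unfolding t0_def t1_def using finN that by auto
  \<comment> \<open>The given polygon is the position at time 0, which the \<open>cone\<close>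
    hypotheses make admissible.\<close>
  have "t0 \<le> 0" "0 \<le> t1"
    using e0 e1 cone[of e0] cone[of e1] by (auto simp: N_def V_def divide_nonneg_neg divide_nonpos_neg)
  have t01: "V \<subseteq> behind t" if "t0 \<le> t" "t \<le> t1" for t
    unfolding behind_iff using t0 t1 that by (meson order_trans)
  define P where "P = (\<lambda>t. convex hull (insert (pt 1 t) V))"
  have areaP: "measure lebesgue (P t) = measure lebesgue (convex hull W)" if "t0 \<le> t" "t \<le> t1" for t
    using measure_hull_insert_apex[OF finV V0 V1] t01[OF that] t01[OF \<open>t0 \<le> 0\<close> \<open>0 \<le> t1\<close>]
    by (simp add: P_def W)
  \<comment> \<open>Only an upper bound is possible, as the moved apex is not known to be a new
    point; it suffices for \<open>IH\<close>.\<close>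
  have cardU: "card (insert (pt 1 t) (V - {x})) < card W" if "x \<in> V" for t x
  proof -
    have "card (insert (pt 1 t) (V - {x})) \<le> Suc (card (V - {x}))"
      by (rule card_insert_le_m1) auto
    also have "\<dots> = card V"
      using finV that by (rule card_Suc_Diff1)
    finally show ?thesis using cardV by simp
  qed
  have end0: "P t0 = convex hull (insert (pt 1 t0) (V - {pt 0 0}))"
    unfolding P_def using e0 by (intro hull_drop_neighbour[of e0]) (auto simp: N_def)
  have end1: "P t1 = convex hull (insert (pt 1 t1) (V - {pt 0 1}))"
    unfolding P_def using e1 by (intro hull_drop_neighbour[of e1]) (auto simp: N_def)
  have b0: "measure lebesgue (cjoin l (P t0)) \<le> c * measure lebesgue (convex hull W)"
    using IH[of "insert (pt 1 t0) (V - {pt 0 0})"] areaP[of t0] area cardU[OF V0] finV \<open>t0 \<le> 0\<close> \<open>0 \<le> t1\<close>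
    unfolding end0 by simp
  have b1: "measure lebesgue (cjoin l (P t1)) \<le> c * measure lebesgue (convex hull W)"
    using IH[of "insert (pt 1 t1) (V - {pt 0 1})"] areaP[of t1] area cardU[OF V1] finV \<open>t0 \<le> 0\<close> \<open>0 \<le> t1\<close>
    unfolding end1 by simp
  have "measure lebesgue (cjoin l (P 0)) \<le> max (measure lebesgue (cjoin l (P t0))) (measure lebesgue (cjoin l (P t1)))"
    unfolding P_def using \<open>t0 \<le> 0\<close> \<open>0 \<le> t1\<close>
    by (intro measure_cjoin_apex_le_max finV V0 V1 t01) auto
  then show ?thesis using b0 b1 by (simp add: P_def W)
qed

lemma measure_cjoin_affine_image:
  assumes "linear g" "bij g" "compact K" "measure lebesgue K > 0"
  shows "measure lebesgue (cjoin l ((\<lambda>y. p + g y) ` K)) = \<bar>det (matrix g)\<bar> * measure lebesgue (cjoin l K)"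
  unfolding cjoin_affine_image[OF assms]
  using measure_linear_image[OF assms(1)] lmeasurable_compact[OF compact_cjoin[OF assms(3)]] .

text \<open>Both areas are multiplied by the same positive number, so a bound on their ratio is
  affinely invariant.\<close>

lemma cjoin_area_bound_affine_image:
  assumes "linear g" "bij g" "compact K" "measure lebesgue K > 0"
  shows "measure lebesgue (cjoin l ((\<lambda>y. p + g y) ` K)) \<le> c * measure lebesgue ((\<lambda>y. p + g y) ` K)
    \<longleftrightarrow> measure lebesgue (cjoin l K) \<le> c * measure lebesgue K"
proof -
  define D where "D = \<bar>det (matrix g)\<bar>"
  have "D > 0" using det_matrix_bij_neq_0[OF assms(1,2)] by (simp add: D_def)
  have "D * A \<le> c * (D * B) \<longleftrightarrow> A \<le> c * B" for A B :: real
    using mult_le_cancel_left_pos[OF \<open>D > 0\<close>, of A "c * B"] by (simp add: ac_simps)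
  then show ?thesis
    unfolding measure_cjoin_affine_image[OF assms] measure_affine_image[OF assms(1,3)]
    by (simp add: D_def)
qed

lemma convex_hull_affine_image:
  assumes "linear g"
  shows "convex hull ((\<lambda>y. p + g y) ` V) = (\<lambda>y. p + g y) ` (convex hull V)"
proof -
  have "(\<lambda>y. p + g y) ` A = (+) p ` g ` A" for A by auto
  then show ?thesis
    by (simp add: convex_hull_translation convex_hull_linear_image[OF assms])
qed

lemma measure_pos_iff_not_negligible:
  assumes "compact K" shows "measure lebesgue K > 0 \<longleftrightarrow> \<not> negligible K"
  using assms by (auto simp: negligible_iff_measure lmeasurable_compact zero_less_measure_iff)

lemma cjoin_area_bound_polygon:
  assumes tri: "\<And>a b d. measure lebesgue (convex hull {a, b, d}) > 0 \<Longrightarrow>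
      measure lebesgue (cjoin l (convex hull {a, b, d})) \<le> c * measure lebesgue (convex hull {a, b, d})"
    and "finite V" "measure lebesgue (convex hull V) > 0"
  shows "measure lebesgue (cjoin l (convex hull V)) \<le> c * measure lebesgue (convex hull V)"
  using assms(2,3)
proof (induction "card V" arbitrary: V rule: less_induct)
  case less
  consider (red) e where "e \<in> V" "e \<in> convex hull (V - {e})"
    | (small) "card V \<le> 3"
    | (irr) "card V > 3" "\<And>e. e \<in> V \<Longrightarrow> e \<notin> convex hull (V - {e})"
    by (meson not_le)
  then show ?case
  proof cases
    case red
    have "card (V - {e}) < card V"
      using red(1) less.prems(1) by (intro psubset_card_mono) auto
    then show ?thesis
      using less.hyps[of "V - {e}"] less.prems convex_hull_Diff_redundant[OF red(2)] by simp
  next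
    case small
    have "V \<noteq> {}" using less.prems(2) by auto
    then have "card V = 1 \<or> card V = 2 \<or> card V = 3"
      using small less.prems(1) by (metis One_nat_def card_0_eq le_SucE le_zero_eq numeral_2_eq_2 numeral_3_eq_3)
    \<comment> \<open>Repetitions are allowed here, which also covers one or two points.\<close>
    then obtain a b d where "V = {a, b, d}"
      by (metis card_1_singletonE card_2_iff card_3_iff insert_absorb2)
    then show ?thesis using tri less.prems(2) by blast
  next
    case irr
    have cpt: "compact (convex hull V)"
      using less.prems(1) by (rule finite_imp_compact_convex_hull)
    have nn: "\<not> negligible (convex hull V)"
      using less.prems(2) measure_pos_iff_not_negligible[OF cpt] by simp
    \<comment> \<open>Any point serves, since by \<open>irr\<close> none is in the hull of the
      others.\<close>
    then obtain v where v: "v \<in> V" by fastforce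
    obtain a b where ab: "a \<in> V - {v}" "b \<in> V - {v}" "cross2 (a - v) (b - v) > 0"
      "\<And>e. e \<in> V \<Longrightarrow> cross2 (a - v) (e - v) \<ge> 0"
      "\<And>e. e \<in> V \<Longrightarrow> cross2 (e - v) (b - v) \<ge> 0"
      using vertex_neighbours[OF less.prems(1) v irr(2)[OF v] nn] by blast
    define g where "g = frame (v - a) (b - a)"
    define f where "f = (\<lambda>y. a + g y)"
    have "cross2 (v - a) (b - a) = - cross2 (a - v) (b - v)"
      by (simp add: cross2_def algebra_simps)
    then have g: "linear g" "bij g"
      using ab(3) by (auto simp: g_def linear_frame intro!: bij_frame)
    have "bij f"
    proof (rule bijI)
      show "inj f"
        using bij_is_inj[OF g(2)] by (simp add: f_def inj_def)
      have "x = f (inv g (x - a))" for x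
        using surj_f_inv_f[OF bij_is_surj[OF g(2)], of "x - a"] by (simp add: f_def)
      then show "surj f"
        unfolding surj_def by blast
    qed
    have f: "f (pt 0 0) = a" "f (pt 0 1) = b" "f (pt 1 0) = v"
      by (simp_all add: f_def g_def)
    define W where "W = f -` V"
    have V: "V = f ` W"
      using \<open>bij f\<close> by (simp add: W_def bij_is_surj)
    have hull: "convex hull (f ` A) = f ` (convex hull A)" for A
      unfolding f_def by (rule convex_hull_affine_image[OF g(1)])
    have inj: "inj_on f A" for A
      using \<open>bij f\<close> by (meson bij_is_inj inj_on_subset subset_UNIV)
    have finW: "finite W"
      using less.prems(1) unfolding V by (rule finite_imageD) (rule inj)
    have cardW: "card W = card V"
      unfolding V by (simp add: card_image[OF inj])
    have cptW: "compact (convex hull W)"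
      using finW by (rule finite_imp_compact_convex_hull)
    have pos: "measure lebesgue (convex hull W) > 0"
    proof -
      have "0 < measure lebesgue (f ` (convex hull W))"
        using less.prems(2) unfolding V hull .
      then show ?thesis
        unfolding f_def measure_affine_image[OF g(1) cptW] by (simp add: zero_less_mult_iff)
    qed
    have "measure lebesgue (cjoin l (convex hull W)) \<le> c * measure lebesgue (convex hull W)"
    proof (rule cjoin_area_bound_normalized[OF finW _ _ _ _ _ _ _ pos])
      show "card W > 3" using irr(1) cardW by simp
      show "e \<notin> convex hull (W - {e})" if "e \<in> W" for e
      proof
        assume "e \<in> convex hull (W - {e})"
        then have "f e \<in> f ` (convex hull (W - {e}))" by (rule imageI)
        also have "\<dots> = convex hull (V - {f e})"
          unfolding hull[symmetric] V using inj[of UNIV] by (simp add: image_set_diff)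
        finally show False using irr(2)[of "f e"] that by (simp add: W_def)
      qed
      show "pt 0 0 \<in> W" "pt 0 1 \<in> W" "pt 1 0 \<in> W"
        using ab(1,2) v f by (auto simp: W_def)
      fix e assume "e \<in> W"
      then have fe: "f e \<in> V" by (simp add: W_def)
      obtain s y where e: "e = pt s y" by (rule pt_cases)
      \<comment> \<open>In terms of the edge vectors at \<open>v\<close> the coefficients are
        \<open>1 - s - y\<close> and \<open>y\<close>; the cross product inequalities for the
        neighbours say that both are nonnegative.\<close>
      have fv: "f e - v = (1 - s - y) *\<^sub>R (a - v) + y *\<^sub>R (b - v)"
        by (simp add: f_def g_def e algebra_simps)
      have "cross2 (a - v) (f e - v) = y * cross2 (a - v) (b - v)"
        "cross2 (f e - v) (b - v) = (1 - s - y) * cross2 (a - v) (b - v)"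
        unfolding fv by (simp_all add: cross2_def algebra_simps)
      then show "0 \<le> e $ 2" "e $ 2 \<le> 1 - e $ 1"
        using ab(4)[OF fe] ab(5)[OF fe] ab(3) by (simp_all add: e zero_le_mult_iff)
    next
      fix U :: "(real^2) set"
      assume "finite U" "card U < card W" "measure lebesgue (convex hull U) > 0"
      then show "measure lebesgue (cjoin l (convex hull U)) \<le> c * measure lebesgue (convex hull U)"
        using less.hyps cardW by simp
    qed
    then show ?thesis
      unfolding V hull unfolding f_def using cjoin_area_bound_affine_image[OF g cptW pos] by blast
  qed
qed

section \<open>All triangles as affine images of one\<close>

definition unit_triangle :: "(real^2) set" where
  "unit_triangle = convex hull {pt 0 0, pt 1 0, pt 0 1}"

lemma triangle_affine_image:
  "convex hull {a, b, c} = (\<lambda>y. a + frame (b - a) (c - a) y) ` unit_triangle"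
  unfolding unit_triangle_def convex_hull_affine_image[OF linear_frame, symmetric] by simp

lemma compact_unit_triangle: "compact unit_triangle"
  unfolding unit_triangle_def by (intro finite_imp_compact_convex_hull) auto

text \<open>An equivalence, because it is used both ways: from \<open>S\<close> to the unit
  triangle, and from there to every triangle of positive area.\<close>

lemma cjoin_area_bound_triangle:
  assumes "measure lebesgue (convex hull {a, b, d}) > 0"
  shows "measure lebesgue (cjoin l (convex hull {a, b, d})) \<le> c * measure lebesgue (convex hull {a, b, d})
    \<longleftrightarrow> measure lebesgue (cjoin l unit_triangle) \<le> c * measure lebesgue unit_triangle"
proof -
  have "\<not> negligible (convex hull {a, b, d})"
    using assms negligible_imp_measure0 by force
  then have "cross2 (b - a) (d - a) \<noteq> 0"
    using negligible_degenerate_triangle by blast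
  moreover have "measure lebesgue unit_triangle > 0"
    using assms unfolding triangle_affine_image
    unfolding measure_affine_image[OF linear_frame compact_unit_triangle]
    by (simp add: zero_less_mult_iff)
  ultimately show ?thesis
    unfolding triangle_affine_image
    by (intro cjoin_area_bound_affine_image[OF linear_frame bij_frame compact_unit_triangle])
qed

subsection \<open>Centroids and polygonal approximation\<close>

lemma convex_body_not_negligible:
  assumes "convex_body K" shows "\<not> negligible K"
  using assms negligible_convex_interior by (auto simp: convex_body_def)

lemma center_of_mass_inner:
  fixes K :: "'a::euclidean_space set"
  assumes "compact K" "measure lebesgue K > 0"
  shows "integral K (\<lambda>y. a \<bullet> (center_of_mass K - y)) = 0"
proof -
  have 1: "(\<lambda>y. y) integrable_on K" "(\<lambda>y. 1::real) integrable_on K"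
    using assms(1) by (auto intro!: integrable_on_compact)
  have "integral K (\<lambda>y. a \<bullet> (center_of_mass K - y))
      = integral K (\<lambda>y. (a \<bullet> center_of_mass K) * 1) - integral K (\<lambda>y. a \<bullet> y)"
    unfolding inner_diff_right mult_1_right using assms(1)
    by (intro integral_diff integrable_on_compact continuous_intros)
  also have "integral K (\<lambda>y. (a \<bullet> center_of_mass K) * 1) = (a \<bullet> center_of_mass K) * measure lebesgue K"
    using assms(1) by (subst integral_mult_right) (simp add: lmeasure_integral lmeasurable_compact)
  also have "integral K (\<lambda>y. a \<bullet> y) = a \<bullet> integral K (\<lambda>y. y)"
    using integral_linear[OF 1(1) bounded_linear_inner_right[of a]] by (simp add: o_def)
  finally show ?thesis
    using assms(2) by (simp add: center_of_mass_def)
qed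

text \<open>Otherwise a hyperplane separates the centroid \<open>x\<close> from the interior, so
  \<open>a \<bullet> (x - y)\<close> is nonnegative on \<open>K\<close> with integral 0. It then
  vanishes on a box inside \<open>K\<close>, which would have to lie in a hyperplane.\<close>

lemma center_of_mass_in_interior:
  assumes "convex_body K"
  shows "center_of_mass K \<in> interior K"
proof (rule ccontr)
  define x where "x = center_of_mass K"
  assume "center_of_mass K \<notin> interior K"
  have K: "compact K" "convex K" "interior K \<noteq> {}"
    using assms by (auto simp: convex_body_def)
  have pos: "measure lebesgue K > 0"
    using convex_body_not_negligible[OF assms] K(1)
    by (auto simp: negligible_iff_measure lmeasurable_compact zero_less_measure_iff)
  obtain a b where ab: "a \<noteq> 0" "\<And>y. y \<in> interior K \<Longrightarrow> a \<bullet> y \<le> b" "b \<le> a \<bullet> x"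
    using separating_hyperplane_sets[of "interior K" "{x}"] K \<open>center_of_mass K \<notin> interior K\<close>
    by (auto simp: x_def convex_interior)
  have "closure (interior K) \<subseteq> {y. a \<bullet> y \<le> b}"
    using ab(2) by (intro closure_minimal closed_halfspace_le) auto
  moreover have "K \<subseteq> closure (interior K)"
    using convex_closure_interior[OF K(2,3)] closure_subset by blast
  ultimately have le: "a \<bullet> (x - y) \<ge> 0" if "y \<in> K" for y
    using that ab(3) by (fastforce simp: inner_diff_right)
  obtain z where "z \<in> interior K" using K(3) by blast
  then obtain u v where uv: "z \<in> box u v" "cbox u v \<subseteq> interior K"
    using open_contains_cbox[OF open_interior] by (metis open_interior)
  have sub: "cbox u v \<subseteq> K" using uv(2) interior_subset by blast
  have cont: "continuous_on S (\<lambda>y. a \<bullet> (x - y))" for S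
    by (intro continuous_intros)
  have "integral (cbox u v) (\<lambda>y. a \<bullet> (x - y)) \<le> integral K (\<lambda>y. a \<bullet> (x - y))"
    using le sub K(1) by (intro integral_subset_le integrable_on_compact cont compact_cbox) auto
  also have "\<dots> = 0"
    unfolding x_def by (rule center_of_mass_inner[OF K(1) pos])
  finally have "integral (cbox u v) (\<lambda>y. a \<bullet> (x - y)) = 0"
    using le sub by (intro antisym integral_nonneg integrable_on_compact cont compact_cbox) auto
  then have "\<forall>y\<in>cbox u v. a \<bullet> (x - y) = 0"
    using integral_cbox_eq_0_iff[OF cont, of u v] uv(1) le sub by blast
  then have "cbox u v \<subseteq> {y. a \<bullet> y = a \<bullet> x}"
    by (auto simp: inner_diff_right)
  then have "negligible (cbox u v)"
    using negligible_hyperplane[of a "a \<bullet> x"] ab(1) negligible_subset by blast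
  then show False
    using uv(1) by (auto simp: negligible_interval)
qed

text \<open>Each point of \<open>B\<close> is interior to a small cube inside \<open>K\<close>; by
  compactness finitely many cubes cover \<open>B\<close>, and \<open>V\<close> collects their
  corners.\<close>

lemma polytope_between:
  fixes K :: "'a::euclidean_space set"
  assumes "compact B" "B \<subseteq> interior K" "convex K"
  obtains V where "finite V" "V \<subseteq> K" "B \<subseteq> convex hull V"
proof -
  have "\<exists>S. finite S \<and> convex hull S \<subseteq> K \<and> z \<in> interior (convex hull S)" if "z \<in> B" for z
  proof -
    obtain e where e: "e > 0" "cball z e \<subseteq> K"
      using assms(2) \<open>z \<in> B\<close> by (meson mem_interior_cball subsetD)
    \<comment> \<open>Dividing by the dimension keeps the sum of the coordinate deviations, and
      hence the norm, at most \<open>e\<close>.\<close>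
    define d where "d = e / DIM('a)"
    have "d > 0" using e by (simp add: d_def)
    let ?D = "\<Sum>i\<in>Basis. d *\<^sub>R i :: 'a"
    have D: "?D \<bullet> i = d" if "i \<in> Basis" for i
      using that by (simp add: inner_sum_left inner_Basis if_distrib sum.delta cong: if_cong)
    obtain S where S: "finite S" "cbox (z - ?D) (z + ?D) = convex hull S"
      using cube_convex_hull[OF \<open>d > 0\<close>] by blast
    have "cbox (z - ?D) (z + ?D) \<subseteq> cball z e"
    proof
      fix y assume "y \<in> cbox (z - ?D) (z + ?D)"
      then have "\<bar>(y - z) \<bullet> i\<bar> \<le> d" if "i \<in> Basis" for i
        using that D by (force simp: mem_box inner_diff_left inner_add_left abs_le_iff)
      then have "(\<Sum>i\<in>Basis. \<bar>(y - z) \<bullet> i\<bar>) \<le> (\<Sum>i\<in>(Basis :: 'a set). d)"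
        by (rule sum_mono)
      then have "norm (y - z) \<le> e"
        using norm_le_l1[of "y - z"] by (simp add: d_def)
      then show "y \<in> cball z e" by (simp add: dist_norm norm_minus_commute)
    qed
    moreover have "z \<in> interior (cbox (z - ?D) (z + ?D))"
      using \<open>d > 0\<close> D by (auto simp: interior_cbox mem_box inner_diff_left inner_add_left)
    ultimately show ?thesis using S e by auto
  qed
  then obtain S where S: "\<And>z. z \<in> B \<Longrightarrow> finite (S z) \<and> convex hull (S z) \<subseteq> K \<and> z \<in> interior (convex hull (S z))"
    by metis
  obtain C where C: "C \<subseteq> B" "finite C" "B \<subseteq> (\<Union>z\<in>C. interior (convex hull (S z)))"
  proof (rule compactE_image[OF assms(1)])
    show "open (interior (convex hull (S z)))" for z by simp
    show "B \<subseteq> (\<Union>z\<in>B. interior (convex hull (S z)))" using S by auto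
  qed
  show ?thesis
  proof
    show "finite (\<Union>z\<in>C. S z)" using C S by auto
    have "S z \<subseteq> K" if "z \<in> B" for z
      using S[OF that] hull_subset[of "S z" convex] by auto
    then show "(\<Union>z\<in>C. S z) \<subseteq> K" using C(1) by (intro UN_least) auto
    have "convex hull (S z) \<subseteq> convex hull (\<Union>z\<in>C. S z)" if "z \<in> C" for z
      using that by (intro hull_mono) auto
    then show "B \<subseteq> convex hull (\<Union>z\<in>C. S z)"
      using C(3) interior_subset by blast
  qed
qed

text \<open>The first moment of \<open>K\<close> about its centroid is 0, so that of
  \<open>P\<close> is minus the moment of \<open>K - P\<close>, where the integrand has norm at most
  \<open>R\<close>.\<close>

lemma norm_center_of_mass_diff_le:
  fixes K P :: "'a::euclidean_space set"
  assumes "compact K" "compact P" "P \<subseteq> K" "measure lebesgue P > 0"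
    and R: "\<And>y. y \<in> K \<Longrightarrow> norm (y - center_of_mass K) \<le> R"
  shows "measure lebesgue P * norm (center_of_mass P - center_of_mass K)
    \<le> R * (measure lebesgue K - measure lebesgue P)"
proof -
  define x where "x = center_of_mass K"
  have m: "K \<in> lmeasurable" "P \<in> lmeasurable" "K - P \<in> lmeasurable"
    using assms by (auto simp: lmeasurable_compact)
  have posK: "measure lebesgue K > 0"
    using assms(3,4) m measure_mono_fmeasurable[of P K lebesgue] by (simp add: fmeasurableD)
  have moment: "integral A (\<lambda>y. y - z) = measure lebesgue A *\<^sub>R (center_of_mass A - z)"
    if "compact A" "measure lebesgue A > 0" for A :: "'a set" and z
  proof -
    have "integral A (\<lambda>y. y - z) = integral A (\<lambda>y. y) - integral A (\<lambda>y. 1 *\<^sub>R z)"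
      using that(1) by (simp, intro integral_diff integrable_on_compact) auto
    also have "integral A (\<lambda>y. 1 *\<^sub>R z) = measure lebesgue A *\<^sub>R z"
      using integrable_integral[OF integrable_on_compact[of A "\<lambda>x. 1 :: real"]] that(1)
      by (intro integral_unique has_integral_scaleR_left) (simp add: lmeasure_integral lmeasurable_compact)
    also have "integral A (\<lambda>y. y) = measure lebesgue A *\<^sub>R center_of_mass A"
      using that(2) by (simp add: center_of_mass_def)
    finally show ?thesis by (simp add: algebra_simps)
  qed
  have intK: "(\<lambda>y. y - x) absolutely_integrable_on K"
    using assms(1) by (intro absolutely_integrable_on_compact continuous_intros)
  have i: "(\<lambda>y. y - x) integrable_on (K - P)" "(\<lambda>y. y - x) integrable_on P"
    using intK m assms(3) set_integrable_subset[OF intK] set_lebesgue_integral_eq_integral(1)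
    by (metis Diff_subset fmeasurableD)+
  have "integral (K - P) (\<lambda>y. y - x) + integral P (\<lambda>y. y - x) = integral ((K - P) \<union> P) (\<lambda>y. y - x)"
    using i Diff_disjoint[of P K] by (intro integral_Un[symmetric]) (simp_all add: Int_commute)
  also have "(K - P) \<union> P = K" using assms(3) by auto
  also have "integral K (\<lambda>y. y - x) = 0"
    using moment[OF assms(1) posK, of x] by (simp add: x_def)
  finally have "measure lebesgue P *\<^sub>R (center_of_mass P - x) = - integral (K - P) (\<lambda>y. y - x)"
    using moment[OF assms(2,4), of x] by (simp add: eq_neg_iff_add_eq_0 add.commute)
  then have "measure lebesgue P * norm (center_of_mass P - x) = norm (integral (K - P) (\<lambda>y. y - x))"
    using assms(4) by (metis abs_of_pos norm_minus_cancel norm_scaleR)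
  also have "\<dots> \<le> integral (K - P) (\<lambda>y. R * 1)"
    using i(1) R m by (intro integral_norm_bound_integral integrable_on_mult_right) 
      (auto simp: x_def integrable_on_const)
  also have "\<dots> = R * (measure lebesgue K - measure lebesgue P)"
    using m assms(3)
    by (subst integral_mult_right) (simp add: lmeasure_integral[symmetric] measurable_measure_Diff fmeasurableD)
  finally show ?thesis by (simp add: x_def)
qed

section \<open>Comparing the join of a convex body with that of a polygon inside it\<close>

lemma measure_scaleR_image:
  fixes K :: "(real^2) set"
  assumes "compact K"
  shows "measure lebesgue ((\<lambda>y. p + r *\<^sub>R y) ` K) = r\<^sup>2 * measure lebesgue K"
proof -
  have "linear (\<lambda>y :: real^2. r *\<^sub>R y)" by (rule linearI) (auto simp: algebra_simps)
  moreover have "det (matrix (\<lambda>y :: real^2. r *\<^sub>R y)) = r\<^sup>2"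
    by (simp add: det_2 matrix_def axis_def power2_eq_square)
  ultimately show ?thesis using measure_affine_image[OF _ assms] by fastforce
qed

text \<open>Once the centroids are aligned, \<open>cjoin\<close> is monotone: the generating points
  of the scaled join are generating points of \<open>cjoin l P\<close>.\<close>

lemma scaleR_cjoin_subset:
  assumes "\<And>y. y \<in> K \<Longrightarrow> center_of_mass P + r *\<^sub>R (y - center_of_mass K) \<in> P"
  shows "(\<lambda>z. r *\<^sub>R z) ` cjoin l K \<subseteq> cjoin l P"
proof -
  let ?x = "center_of_mass K" and ?p = "center_of_mass P"
  have lin: "linear (\<lambda>z :: real^2. r *\<^sub>R z)" by (rule linearI) (auto simp: algebra_simps)
  have eq: "r *\<^sub>R (1 - l) *\<^sub>R (y - ?x) = (1 - l) *\<^sub>R ((?p + r *\<^sub>R (y - ?x)) - ?p)"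
    "r *\<^sub>R l *\<^sub>R (?x - y) = l *\<^sub>R (?p - (?p + r *\<^sub>R (y - ?x)))" for y
    by (simp_all add: algebra_simps)
  show ?thesis
    unfolding cjoin_def cvx_join_def convex_hull_linear_image[OF lin] image_Un image_image
    by (intro hull_mono Un_mono image_subsetI; rule image_eqI[OF _ assms]; (rule eq | assumption))
qed

lemma cjoin_area_bound_convex_body:
  assumes poly: "\<And>V. finite V \<Longrightarrow> measure lebesgue (convex hull V) > 0 \<Longrightarrow>
      measure lebesgue (cjoin l (convex hull V)) \<le> c * measure lebesgue (convex hull V)"
    and "0 \<le> c" "convex_body K"
  shows "measure lebesgue (cjoin l K) \<le> c * measure lebesgue K"
proof -
  define x where "x = center_of_mass K"
  have K: "compact K" "convex K"
    using assms(3) by (auto simp: convex_body_def)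
  have M: "measure lebesgue K > 0"
    using convex_body_not_negligible[OF assms(3)] measure_pos_iff_not_negligible[OF K(1)] by simp
  obtain r where r: "r > 0" "cball x r \<subseteq> K"
    using center_of_mass_in_interior[OF assms(3)] by (metis mem_interior_cball x_def)
  have "bounded ((\<lambda>y. y - x) ` K)"
    using K(1) by (intro compact_imp_bounded compact_continuous_image continuous_intros)
  then obtain R where R: "R > 0" "\<And>y. y \<in> K \<Longrightarrow> norm (y - x) \<le> R"
    unfolding bounded_pos by auto
  \<comment> \<open>With area of \<open>P\<close> at least a quarter of that of \<open>K\<close> and
    area loss at most \<open>2 * \<epsilon>\<close> times the area of \<open>K\<close>, the centroid
    moves by at most \<open>8 * R * \<epsilon>\<close>, which is
    \<open>C * \<epsilon> * r\<close>.\<close>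
  define C where "C = 8 * R / r"
  have C: "C > 0" using r R by (simp add: C_def)
  have key: "(1 - (1 + C) * \<epsilon>)\<^sup>2 * measure lebesgue (cjoin l K) \<le> c * measure lebesgue K"
    if \<epsilon>: "0 < \<epsilon>" "\<epsilon> < 1/2" "(1 + C) * \<epsilon> < 1" for \<epsilon>
  proof -
    \<comment> \<open>The copy of \<open>K\<close> shrunk about its centroid; it lies in the
      interior, which leaves room for a polygon.\<close>
    define B where "B = (\<lambda>y. \<epsilon> *\<^sub>R x + (1 - \<epsilon>) *\<^sub>R y) ` K"
    have "compact B"
      unfolding B_def by (intro compact_continuous_image continuous_intros K)
    moreover have "B \<subseteq> interior K"
    proof -
      have "y - \<epsilon> *\<^sub>R (y - x) \<in> interior K" if "y \<in> K" for y
        using mem_interior_convex_shrink[OF K(2) _ that] center_of_mass_in_interior[OF assms(3)] \<epsilon>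
        by (simp add: x_def)
      then show ?thesis by (auto simp: B_def algebra_simps)
    qed
    ultimately obtain V where V: "finite V" "V \<subseteq> K" "B \<subseteq> convex hull V"
      using polytope_between[OF _ _ K(2)] by blast
    define P where "P = convex hull V"
    define p where "p = center_of_mass P"
    have P: "compact P" "convex P" "P \<subseteq> K" "B \<subseteq> P"
      using V K(2) by (auto simp: P_def finite_imp_compact_convex_hull hull_minimal)
    have mP: "(1 - \<epsilon>)\<^sup>2 * measure lebesgue K \<le> measure lebesgue P"
    proof -
      have "measure lebesgue B \<le> measure lebesgue P"
        using P \<open>compact B\<close> by (intro measure_mono_fmeasurable) (auto simp: lmeasurable_compact fmeasurableD)
      then show ?thesis
        unfolding B_def measure_scaleR_image[OF K(1)] .
    qed
    have e4: "1/4 \<le> (1 - \<epsilon>)\<^sup>2"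
      using \<epsilon> power_mono[of "1/2" "1 - \<epsilon>" 2] by (simp add: power2_eq_square)
    then have mP4: "measure lebesgue K / 4 \<le> measure lebesgue P"
      using mP mult_right_mono[of "1/4" "(1 - \<epsilon>)\<^sup>2" "measure lebesgue K"] by simp
    then have posP: "measure lebesgue P > 0"
      using M by linarith
    have PK: "measure lebesgue P \<le> measure lebesgue K"
      using P K by (intro measure_mono_fmeasurable) (auto simp: lmeasurable_compact fmeasurableD)
    have "norm (p - x) \<le> C * \<epsilon> * r"
    proof -
      have "measure lebesgue K / 4 * norm (p - x) \<le> measure lebesgue P * norm (p - x)"
        by (rule mult_right_mono[OF mP4 norm_ge_zero])
      also have "\<dots> \<le> R * (measure lebesgue K - measure lebesgue P)"
        unfolding p_def x_def
        by (rule norm_center_of_mass_diff_le[OF K(1) P(1,3) posP]) (use R(2) in \<open>simp add: x_def\<close>)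
      also have "\<dots> \<le> R * (2 * \<epsilon> * measure lebesgue K)"
      proof (intro mult_left_mono)
        have "(1 - 2 * \<epsilon>) * measure lebesgue K \<le> (1 - \<epsilon>)\<^sup>2 * measure lebesgue K"
          by (intro mult_right_mono) (auto simp: power2_eq_square algebra_simps)
        then show "measure lebesgue K - measure lebesgue P \<le> 2 * \<epsilon> * measure lebesgue K"
          using mP by (simp add: algebra_simps)
      qed (use R in simp)
      finally have "measure lebesgue K * norm (p - x) \<le> measure lebesgue K * (8 * R * \<epsilon>)"
        by (simp add: algebra_simps)
      then have "norm (p - x) \<le> 8 * R * \<epsilon>"
        using M by simp
      then show ?thesis using r by (simp add: C_def)
    qed
    have "p + (1 - (1 + C) * \<epsilon>) *\<^sub>R (y - x) \<in> P" if "y \<in> K" for y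
    proof -
      \<comment> \<open>The centroid shift \<open>p - x\<close> is \<open>C * \<epsilon>\<close>
        times \<open>q - x\<close> with \<open>q\<close> in the ball around \<open>x\<close>, hence
        in \<open>K\<close>. Mixing \<open>y\<close> with \<open>q\<close> by the weight
        \<open>\<theta>\<close> absorbs the shift; \<open>\<theta> \<le> 1\<close> follows from
        \<open>(1 + C) * \<epsilon> < 1\<close>.\<close>
      define q where "q = x + (1 / (C * \<epsilon>)) *\<^sub>R (p - x)"
      have Ce: "C * \<epsilon> > 0" using C \<epsilon> by simp
      have "norm (q - x) \<le> r"
        using \<open>norm (p - x) \<le> C * \<epsilon> * r\<close> Ce C \<epsilon> by (simp add: q_def divide_le_eq mult.commute)
      then have "q \<in> K"
        using r(2) by (auto simp: dist_norm norm_minus_commute)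
      define \<theta> where "\<theta> = C * \<epsilon> / (1 - \<epsilon>)"
      have \<theta>: "0 \<le> \<theta>" "\<theta> \<le> 1" "(1 - \<epsilon>) * \<theta> = C * \<epsilon>"
        using \<epsilon> Ce by (simp_all add: \<theta>_def divide_le_eq distrib_right)
      define w where "w = (1 - \<theta>) *\<^sub>R y + \<theta> *\<^sub>R q"
      have "w \<in> K"
        unfolding w_def using \<theta> \<open>y \<in> K\<close> \<open>q \<in> K\<close> by (intro convexD[OF K(2)]) auto
      then have inP: "\<epsilon> *\<^sub>R x + (1 - \<epsilon>) *\<^sub>R w \<in> P"
        using P(4) by (auto simp: B_def)
      have w: "(1 - \<epsilon>) *\<^sub>R w = (1 - \<epsilon> - C * \<epsilon>) *\<^sub>R y + (C * \<epsilon>) *\<^sub>R q"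
        unfolding w_def scaleR_add_right scaleR_scaleR right_diff_distrib \<theta>(3) by simp
      have q: "(C * \<epsilon>) *\<^sub>R q = (C * \<epsilon>) *\<^sub>R x + (p - x)"
        using C \<epsilon> by (simp add: q_def scaleR_add_right)
      have "\<epsilon> *\<^sub>R x + (1 - \<epsilon>) *\<^sub>R w = p + (1 - (1 + C) * \<epsilon>) *\<^sub>R (y - x)"
        unfolding w q by (simp add: algebra_simps)
      with inP show ?thesis by argo
    qed
    then have "(\<lambda>z. (1 - (1 + C) * \<epsilon>) *\<^sub>R z) ` cjoin l K \<subseteq> cjoin l P"
      unfolding p_def x_def by (rule scaleR_cjoin_subset)
    then have "measure lebesgue ((\<lambda>z. 0 + (1 - (1 + C) * \<epsilon>) *\<^sub>R z) ` cjoin l K) \<le> measure lebesgue (cjoin l P)"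
      using compact_cjoin[OF K(1)] compact_cjoin[OF P(1)]
      by (intro measure_mono_fmeasurable)
        (auto intro!: fmeasurableD lmeasurable_compact compact_continuous_image continuous_intros)
    also have "\<dots> \<le> c * measure lebesgue P"
      using poly[OF V(1)] posP by (simp add: P_def)
    also have "\<dots> \<le> c * measure lebesgue K"
      using PK assms(2) by (rule mult_left_mono)
    finally show ?thesis
      unfolding measure_scaleR_image[OF compact_cjoin[OF K(1)]] .
  qed
  \<comment> \<open>Letting \<open>\<epsilon>\<close> tend to 0 from the right removes the scaling
    factor.\<close>
  have lim: "((\<lambda>\<epsilon>. (1 - (1 + C) * \<epsilon>)\<^sup>2 * measure lebesgue (cjoin l K)) \<longlongrightarrow>
      (1 - (1 + C) * 0)\<^sup>2 * measure lebesgue (cjoin l K)) (at_right 0)"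
    by (intro tendsto_intros)
  have "\<forall>\<^sub>F \<epsilon> in at_right 0. (1 - (1 + C) * \<epsilon>)\<^sup>2 * measure lebesgue (cjoin l K) \<le> c * measure lebesgue K"
    using key C unfolding eventually_at_right_field
    by (intro exI[of _ "min (1/2) (1 / (1 + C))"]) (auto simp: less_divide_eq mult.commute)
  from tendsto_upperbound[OF lim this] show ?thesis by simp
qed

theorem theorem4p1:
  fixes K S :: "(real^2) set" and l :: real and x :: "real^2"
  assumes "convex_body K"
    and "0 \<le> l" and "l \<le> 1"
    and "x = center_of_mass K"
    and "is_triangle S"
    and "center_of_mass S = 0"
    and "measure lebesgue S = measure lebesgue K"
  shows "measure lebesgue
           ((\<lambda>y. (1 - l) *\<^sub>R (y - x)) ` K \<squnion>\<^sub>c (\<lambda>y. l *\<^sub>R (x - y)) ` K)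
         \<le> measure lebesgue
           ((\<lambda>y. (1 - l) *\<^sub>R y) ` S \<squnion>\<^sub>c (\<lambda>y. - (l *\<^sub>R y)) ` S)"
proof -
  have "compact K" using assms(1) by (simp add: convex_body_def)
  then have M: "measure lebesgue K > 0"
    using convex_body_not_negligible[OF assms(1)] by (simp add: measure_pos_iff_not_negligible)
  obtain a b d where S: "S = convex hull {a, b, d}"
    using assms(5) by (auto simp: is_triangle_def)
  \<comment> \<open>The ratio attained by \<open>S\<close> itself, so that the general bound becomes
    an equality there.\<close>
  define c where "c = measure lebesgue (cjoin l S) / measure lebesgue S"
  have cS: "measure lebesgue (cjoin l S) = c * measure lebesgue S"
    using M assms(7) by (simp add: c_def)
  then have unit: "measure lebesgue (cjoin l unit_triangle) \<le> c * measure lebesgue unit_triangle"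
    using cjoin_area_bound_triangle[of a b d l c] M assms(7) by (simp add: S)
  have tri: "measure lebesgue (cjoin l (convex hull {a, b, d})) \<le> c * measure lebesgue (convex hull {a, b, d})"
    if "measure lebesgue (convex hull {a, b, d}) > 0" for a b d
    using cjoin_area_bound_triangle[OF that] unit by blast
  have "measure lebesgue (cjoin l (convex hull V)) \<le> c * measure lebesgue (convex hull V)"
    if "finite V" "measure lebesgue (convex hull V) > 0" for V
    by (rule cjoin_area_bound_polygon[OF tri that])
  then have "measure lebesgue (cjoin l K) \<le> c * measure lebesgue K"
    by (rule cjoin_area_bound_convex_body) (auto simp: c_def assms(1))
  also have "\<dots> = measure lebesgue (cjoin l S)"
    using cS assms(7) by simp
  finally show ?thesis
    \<comment> \<open>As the centroid of \<open>S\<close> is 0, \<open>cjoin l S\<close> is exactly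
      the right-hand join.\<close>
    by (simp add: cjoin_def assms(4,6))
qed

end
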